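(* Consider the vacuum pp-wave with $f(\zeta,u)=e^{4A(u)}\zeta^2$, where $A=A(u)$ is a complex-valued function, and suppose that $\Delta\gamma=0$ and $\operatorname{Re}\gamma\neq0$. Then, without loss of generality (i.e. after a form-preserving change of coordinates), $$f(\zeta,u)=k_1\,u^{2ik_0-2}\,\zeta^2,$$ where $k_0,k_1$ are real constants.
   Context: Setting. Everything is local, on a small connected coordinate domain with coordinates $(\zeta,\bar\zeta,u,v)$, $\zeta$ complex, $u,v$ real; $^*$ (or a bar) is complex conjugation. A (non-flat) vacuum pp-wave is a metric $ds^2=2\,d\zeta\,d\bar\zeta-2\,du\,dv-2(f+\bar f)\,du^2$ with $f=f(\zeta,u)$ complex analytic in $\zeta$, smooth in $u$, $f_{\zeta\zeta}\neq0$. ($f$ matters only modulo adding a purely imaginary function of $u$.) Form-preserving coordinate changes: $\hat\zeta=e^{i\kappa}(\zeta+b(u))$, $\hat u=(u+u_0)/c$, $\hat v=c\,(v+b'(u)\bar\zeta+\bar b'(u)\zeta+m(u))$, $\hat f=c^2\big(f-\bar b''(u)\zeta+\tfrac12(b'\bar b'-m'(u))\big)$ with $\kappa,u_0,c\neq0$ real constants, $b$ complex-valued, $m$ real-valued. For $f=e^{4A(u)}\zeta^2$, in any null tetrad aligned with the covariantly constant null vector and normalized by $\Psi_4=1$, the Newman–Penrose spin coefficient $\alpha$ vanishes and $\gamma=\frac{1}{\sqrt2}e^{-2\operatorname{Re}A}\,(A_u)^*$, a function of $u$; on functions of $u$ the tetrad derivative is $\Delta=\frac1{\sqrt2}e^{-2\operatorname{Re}A}\,\frac{d}{du}$,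 so $\Delta\gamma=0$ means that $\gamma$ is constant. *)

theory Defs
  imports "HOL-Analysis.Analysis"
begin

section \<open>Smooth functions\<close>

primrec Ck_on :: "nat \<Rightarrow> 'a::real_normed_vector set \<Rightarrow> ('a \<Rightarrow> 'b::real_normed_vector) \<Rightarrow> bool" where
  "Ck_on 0 S F \<longleftrightarrow> continuous_on S F"
| "Ck_on (Suc k) S F \<longleftrightarrow>
     (\<forall>x\<in>S. F differentiable (at x)) \<and>
     (\<forall>w. Ck_on k S (\<lambda>x. frechet_derivative F (at x) w))"

definition smooth_on :: "'a::real_normed_vector set \<Rightarrow> ('a \<Rightarrow> 'b::real_normed_vector) \<Rightarrow> bool" where
  "smooth_on S F \<longleftrightarrow> (\<forall>k. Ck_on k S F)"


section \<open>Coordinates and tensor calculus\<close>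

text \<open>A point is \<open>(\<zeta>, u, v)\<close>. Tensor indices have type \<open>4\<close> and refer to the complex
  coordinate frame: 1, 2, 3, 4 stand for \<open>\<zeta>\<close>, the conjugate of \<open>\<zeta>\<close>, \<open>u\<close>, \<open>v\<close>. A vector
  of type \<open>complex^4\<close> is thus an element of the complexified tangent space.\<close>

type_synonym point = "complex \<times> real \<times> real"

definition u_range :: "point set \<Rightarrow> real set" where
  "u_range D = (\<lambda>(\<zeta>, u, v). u) ` D"

text \<open>For the indices 1 and 2 these are the Wirtinger derivatives.\<close>

definition pderiv_coord :: "4 \<Rightarrow> (point \<Rightarrow> complex) \<Rightarrow> point \<Rightarrow> complex" where
  "pderiv_coord a F p = (let F' = frechet_derivative F (at p) in
     if a = 1 then (F' (1, 0, 0) - \<i> * F' (\<i>, 0, 0)) / 2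
     else if a = 2 then (F' (1, 0, 0) + \<i> * F' (\<i>, 0, 0)) / 2
     else if a = 3 then F' (0, 1, 0)
     else F' (0, 0, 1))"

text \<open>Conjugation on the complexified tangent space also exchanges the first two frame vectors.\<close>

definition vec_cnj :: "complex^4 \<Rightarrow> complex^4" where
  "vec_cnj X = (\<chi> a. if a = 1 then cnj (X $ 2) else if a = 2 then cnj (X $ 1) else cnj (X $ a))"

definition inner_g :: "complex^4^4 \<Rightarrow> complex^4 \<Rightarrow> complex^4 \<Rightarrow> complex" where
  "inner_g G X Y = (\<Sum>a\<in>UNIV. \<Sum>b\<in>UNIV. G $ a $ b * X $ a * Y $ b)"

text \<open>\<open>christoffel g p a b c\<close> is \<open>\<Gamma>\<^sup>a\<^sub>b\<^sub>c\<close>, \<open>riemann_up g p a b c d\<close> is the curvature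
  with first index \<open>a\<close> raised.\<close>

definition christoffel :: "(point \<Rightarrow> complex^4^4) \<Rightarrow> point \<Rightarrow> 4 \<Rightarrow> 4 \<Rightarrow> 4 \<Rightarrow> complex" where
  "christoffel g p a b c =
     (\<Sum>d\<in>UNIV. matrix_inv (g p) $ a $ d *
        (pderiv_coord b (\<lambda>q. g q $ d $ c) p + pderiv_coord c (\<lambda>q. g q $ d $ b) p
          - pderiv_coord d (\<lambda>q. g q $ b $ c) p)) / 2"

definition riemann_up :: "(point \<Rightarrow> complex^4^4) \<Rightarrow> point \<Rightarrow> 4 \<Rightarrow> 4 \<Rightarrow> 4 \<Rightarrow> 4 \<Rightarrow> complex" where
  "riemann_up g p a b c d =
     pderiv_coord c (\<lambda>q. christoffel g q a d b) p - pderiv_coord d (\<lambda>q. christoffel g q a c b) p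
     + (\<Sum>e\<in>UNIV. christoffel g p a c e * christoffel g p e d b
                - christoffel g p a d e * christoffel g p e c b)"

definition riemann :: "(point \<Rightarrow> complex^4^4) \<Rightarrow> point \<Rightarrow> 4 \<Rightarrow> 4 \<Rightarrow> 4 \<Rightarrow> 4 \<Rightarrow> complex" where
  "riemann g p a b c d = (\<Sum>e\<in>UNIV. g p $ a $ e * riemann_up g p e b c d)"

definition ricci :: "(point \<Rightarrow> complex^4^4) \<Rightarrow> point \<Rightarrow> 4 \<Rightarrow> 4 \<Rightarrow> complex" where
  "ricci g p b d = (\<Sum>a\<in>UNIV. riemann_up g p a b a d)"

definition scalar_curv :: "(point \<Rightarrow> complex^4^4) \<Rightarrow> point \<Rightarrow> complex" where
  "scalar_curv g p = (\<Sum>b\<in>UNIV. \<Sum>d\<in>UNIV. matrix_inv (g p) $ b $ d * ricci g p b d)"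

definition weyl :: "(point \<Rightarrow> complex^4^4) \<Rightarrow> point \<Rightarrow> 4 \<Rightarrow> 4 \<Rightarrow> 4 \<Rightarrow> 4 \<Rightarrow> complex" where
  "weyl g p a b c d = riemann g p a b c d
     - (g p $ a $ c * ricci g p b d - g p $ a $ d * ricci g p b c
        + g p $ b $ d * ricci g p a c - g p $ b $ c * ricci g p a d) / 2
     + scalar_curv g p / 6 * (g p $ a $ c * g p $ b $ d - g p $ a $ d * g p $ b $ c)"

definition lower :: "(point \<Rightarrow> complex^4^4) \<Rightarrow> (point \<Rightarrow> complex^4) \<Rightarrow> 4 \<Rightarrow> point \<Rightarrow> complex" where
  "lower g X a p = (\<Sum>c\<in>UNIV. g p $ a $ c * X p $ c)"

text \<open>\<open>cov_deriv g X a b p\<close> is \<open>X\<^sub>a\<^sub>;\<^sub>b\<close>: the second index is the direction of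
  differentiation.\<close>

definition cov_deriv ::
  "(point \<Rightarrow> complex^4^4) \<Rightarrow> (point \<Rightarrow> complex^4) \<Rightarrow> 4 \<Rightarrow> 4 \<Rightarrow> point \<Rightarrow> complex" where
  "cov_deriv g X a b p =
     pderiv_coord b (lower g X a) p - (\<Sum>c\<in>UNIV. christoffel g p c b a * lower g X c p)"


section \<open>Null tetrads and Newman-Penrose quantities\<close>

text \<open>Signature \<open>(+,+,+,-)\<close>: real null fields \<open>l\<close>, \<open>n\<close> and a complex null field \<open>m\<close> with
  \<open>g(l,n) = -1\<close>, \<open>g(m, m\<^sup>*) = 1\<close> and all other products zero. No orientation or time
  orientation is prescribed; reversing one of them replaces \<open>\<gamma>\<close> by its conjugate or its negative.\<close>

definition null_tetrad ::
  "point set \<Rightarrow> (point \<Rightarrow> complex^4^4) \<Rightarrow> (point \<Rightarrow> complex^4) \<Rightarrow> (point \<Rightarrow> complex^4)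
    \<Rightarrow> (point \<Rightarrow> complex^4) \<Rightarrow> bool" where
  "null_tetrad D g l n m \<longleftrightarrow>
     smooth_on D l \<and> smooth_on D n \<and> smooth_on D m \<and>
     (\<forall>p\<in>D. vec_cnj (l p) = l p \<and> vec_cnj (n p) = n p \<and>
        inner_g (g p) (l p) (l p) = 0 \<and> inner_g (g p) (n p) (n p) = 0 \<and>
        inner_g (g p) (m p) (m p) = 0 \<and>
        inner_g (g p) (l p) (m p) = 0 \<and> inner_g (g p) (n p) (m p) = 0 \<and>
        inner_g (g p) (l p) (n p) = -1 \<and> inner_g (g p) (m p) (vec_cnj (m p)) = 1)"

definition np_Psi4 ::
  "(point \<Rightarrow> complex^4^4) \<Rightarrow> (point \<Rightarrow> complex^4) \<Rightarrow> (point \<Rightarrow> complex^4) \<Rightarrow> point \<Rightarrow> complex" where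
  "np_Psi4 g n m p = (\<Sum>a\<in>UNIV. \<Sum>b\<in>UNIV. \<Sum>c\<in>UNIV. \<Sum>d\<in>UNIV.
     weyl g p a b c d * n p $ a * vec_cnj (m p) $ b * n p $ c * vec_cnj (m p) $ d)"

text \<open>\<open>\<gamma> = - (l\<^sub>a\<^sub>;\<^sub>b n\<^sup>a n\<^sup>b - m\<^sub>a\<^sub>;\<^sub>b (m\<^sup>*)\<^sup>a n\<^sup>b) / 2\<close>; the overall sign is the one that
  goes with signature \<open>(+,+,+,-)\<close>.\<close>

definition np_gamma ::
  "(point \<Rightarrow> complex^4^4) \<Rightarrow> (point \<Rightarrow> complex^4) \<Rightarrow> (point \<Rightarrow> complex^4)
    \<Rightarrow> (point \<Rightarrow> complex^4) \<Rightarrow> point \<Rightarrow> complex" where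
  "np_gamma g l n m p =
     - ((\<Sum>a\<in>UNIV. \<Sum>b\<in>UNIV. cov_deriv g l a b p * n p $ a * n p $ b)
        - (\<Sum>a\<in>UNIV. \<Sum>b\<in>UNIV. cov_deriv g m a b p * vec_cnj (m p) $ a * n p $ b)) / 2"

definition np_Delta :: "(point \<Rightarrow> complex^4) \<Rightarrow> (point \<Rightarrow> complex) \<Rightarrow> point \<Rightarrow> complex" where
  "np_Delta n F p = (\<Sum>a\<in>UNIV. n p $ a * pderiv_coord a F p)"


section \<open>Vacuum pp-waves\<close>

text \<open>\<open>ds\<^sup>2 = 2 d\<zeta> d\<zeta>\<^sup>* - 2 du dv - 2 (f + f\<^sup>*) du\<^sup>2\<close>\<close>

definition pp_metric :: "(complex \<Rightarrow> real \<Rightarrow> complex) \<Rightarrow> point \<Rightarrow> complex^4^4" where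
  "pp_metric f = (\<lambda>(\<zeta>, u, v). \<chi> a b.
     if (a, b) = (1, 2) \<or> (a, b) = (2, 1) then 1
     else if (a, b) = (3, 4) \<or> (a, b) = (4, 3) then -1
     else if (a, b) = (3, 3) then - 2 * (f \<zeta> u + cnj (f \<zeta> u))
     else 0)"

definition vacuum_pp_wave :: "point set \<Rightarrow> (complex \<Rightarrow> real \<Rightarrow> complex) \<Rightarrow> bool" where
  "vacuum_pp_wave D f \<longleftrightarrow> open D \<and> connected D \<and> D \<noteq> {} \<and>
     smooth_on D (\<lambda>(\<zeta>, u, v). f \<zeta> u) \<and>
     (\<forall>(\<zeta>, u, v)\<in>D. (\<lambda>z. f z u) analytic_on {\<zeta>} \<and> deriv (deriv (\<lambda>z. f z u)) \<zeta> \<noteq> 0)"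

text \<open>The covariantly constant null vector of a pp-wave in these coordinates is \<open>\<partial>\<^sub>v\<close>.\<close>

definition aligned_tetrad :: "point set \<Rightarrow> (point \<Rightarrow> complex^4) \<Rightarrow> bool" where
  "aligned_tetrad D l \<longleftrightarrow> (\<forall>p\<in>D. \<exists>B. l p = B *s axis 4 1)"

definition form_preserving_map ::
  "real \<Rightarrow> real \<Rightarrow> real \<Rightarrow> (real \<Rightarrow> complex) \<Rightarrow> (real \<Rightarrow> real) \<Rightarrow> point \<Rightarrow> point" where
  "form_preserving_map \<kappa> u0 c b m = (\<lambda>(\<zeta>, u, v).
     (let b' = vector_derivative b (at u) in
       (cis \<kappa> * (\<zeta> + b u), (u + u0) / c, c * (v + Re (b' * cnj \<zeta> + cnj b' * \<zeta>) + m u))))"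

text \<open>\<open>f2\<close> on \<open>D2\<close> is what a form-preserving change of coordinates turns \<open>f\<close> on \<open>D\<close> into.\<close>

definition form_preserving_change ::
  "point set \<Rightarrow> (complex \<Rightarrow> real \<Rightarrow> complex) \<Rightarrow> point set \<Rightarrow> (complex \<Rightarrow> real \<Rightarrow> complex) \<Rightarrow> bool" where
  "form_preserving_change D f D2 f2 \<longleftrightarrow>
     (\<exists>\<kappa> u0 c b m. c \<noteq> 0 \<and> smooth_on (u_range D) b \<and> smooth_on (u_range D) m \<and>
        D2 = form_preserving_map \<kappa> u0 c b m ` D \<and>
        (\<forall>(\<zeta>, u, v)\<in>D.
           let b' = vector_derivative b (at u);
               b'' = vector_derivative (\<lambda>s. vector_derivative b (at s)) (at u);
               m' = deriv m u
           in f2 (cis \<kappa> * (\<zeta> + b u)) ((u + u0) / c)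
                = of_real (c\<^sup>2) * (f \<zeta> u - cnj b'' * \<zeta> + (b' * cnj b' - of_real m') / 2)))"

end

theory Submission
  imports Defs
begin

text \<open>
  Write \<open>l = B \<partial>\<^sub>v\<close> and let \<open>\<mu>\<close> be the nonzero one of the two components of \<open>m\<close> along \<open>\<zeta>\<close> and its
  conjugate. The condition \<open>\<Psi>\<^sub>4 = 1\<close> says \<open>B\<^sup>2 = 2 e\<^sup>4\<^sup>A (\<mu>\<^sup>*)\<^sup>2\<close> up to conjugation of \<open>A\<close>; differentiating
  it along \<open>n\<close>, together with \<open>\<mu> \<mu>\<^sup>* = 1\<close>, gives \<open>\<gamma> = A\<^sub>u / B\<close> or its conjugate without ever choosing a square
  root. Since \<open>\<gamma>\<^sup>2\<close> is then half the square of \<open>K = A\<^sub>u e\<^sup>-\<^sup>2\<^sup>R\<^sup>e\<^sup>A\<close> (or of its conjugate), \<open>\<Delta>\<gamma> = 0\<close> makes \<open>K\<close>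
  constant. In \<open>A\<^sub>u = K e\<^sup>2\<^sup>R\<^sup>e\<^sup>A\<close> the function \<open>e\<^sup>-\<^sup>2\<^sup>R\<^sup>e\<^sup>A\<close> is affine in \<open>u\<close> and \<open>Im A\<close> is affine in \<open>Re A\<close>;
  a translation and reflection of \<open>u\<close> and a rotation of \<open>\<zeta>\<close> normalize the integration constants.
\<close>

section \<open>Derivatives in the complex coordinate frame\<close>

lemma frechet_derivative_cong_open:
  assumes "open D" "p \<in> D" "\<And>q. q \<in> D \<Longrightarrow> F q = G q"
  shows "frechet_derivative F (at p) = frechet_derivative G (at p)"
proof -
  have "(F has_derivative F') (at p) \<longleftrightarrow> (G has_derivative F') (at p)" for F'
    using assms by (metis has_derivative_transform_within_open)
  then show ?thesis
    by (simp add: frechet_derivative_def)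
qed

lemma pderiv_coord_cong_open:
  assumes "open D" "p \<in> D" "\<And>q. q \<in> D \<Longrightarrow> F q = G q"
  shows "pderiv_coord a F p = pderiv_coord a G p"
  using frechet_derivative_cong_open[OF assms] by (simp add: pderiv_coord_def)

lemma pderiv_coord_const [simp]: "pderiv_coord a (\<lambda>q. c) p = 0"
  by (simp add: pderiv_coord_def)

lemma pderiv_coord_zero_open:
  assumes "open D" "p \<in> D" "\<And>q. q \<in> D \<Longrightarrow> F q = c"
  shows "pderiv_coord a F p = 0"
  using pderiv_coord_cong_open[OF assms, where a = a] by simp

lemma has_derivative_u:
  fixes R :: "real \<Rightarrow> complex" and p :: point
  assumes "(R has_vector_derivative R') (at (fst (snd p)))"
  shows "((\<lambda>q. R (fst (snd q))) has_derivative (\<lambda>h. fst (snd h) *\<^sub>R R')) (at p)"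
proof -
  have "((\<lambda>q::point. fst (snd q)) has_derivative (\<lambda>h. fst (snd h))) (at p)"
    by (auto intro!: derivative_eq_intros)
  from has_derivative_compose[OF this] show ?thesis
    using assms by (simp add: has_vector_derivative_def)
qed

text \<open>The varying metric entry and the nonzero Christoffel symbols have this shape on the
  domain: a holomorphic plus an antiholomorphic monomial in \<open>z\<close>, with coefficients
  depending on \<open>u\<close>. Each Wirtinger derivative sees only one of the two summands. For
  exponent 0 the truncated \<open>j - 1\<close> is harmless, since the factor
  \<open>of_nat j\<close> vanishes.\<close>

lemma pderiv_coord_monomial:
  fixes P Q :: "real \<Rightarrow> complex" and j k :: nat
  assumes "(P has_vector_derivative P') (at u)" "(Q has_vector_derivative Q') (at u)"
  defines "F \<equiv> \<lambda>(z, u, v). P u * z ^ j + cnj (Q u * z ^ k)"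
  shows "pderiv_coord 1 F (z, u, v) = of_nat j * P u * z ^ (j - 1)"
    and "pderiv_coord 2 F (z, u, v) = cnj (of_nat k * Q u * z ^ (k - 1))"
    and "pderiv_coord 3 F (z, u, v) = P' * z ^ j + cnj (Q' * z ^ k)"
    and "pderiv_coord 4 F (z, u, v) = 0"
proof -
  let ?p = "(z, u, v)"
  have coeff: "((\<lambda>q. R (fst (snd q))) has_derivative (\<lambda>h. fst (snd h) *\<^sub>R R')) (at ?p)"
    if "(R has_vector_derivative R') (at u)" for R :: "real \<Rightarrow> complex" and R'
    using that by (intro has_derivative_u) simp
  have mono: "((\<lambda>q::point. R (fst (snd q)) * fst q ^ i) has_derivative
      (\<lambda>h. R u * (of_nat i * fst h * z ^ (i - 1)) + (fst (snd h) *\<^sub>R R') * z ^ i)) (at ?p)"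
    if "(R has_vector_derivative R') (at u)" for R :: "real \<Rightarrow> complex" and R' i
    by (rule derivative_eq_intros coeff[OF that] refl | simp add: ac_simps)+
  have F: "F = (\<lambda>q. P (fst (snd q)) * fst q ^ j + cnj (Q (fst (snd q)) * fst q ^ k))"
    by (auto simp: F_def)
  have "(F has_derivative (\<lambda>h. P u * (of_nat j * fst h * z ^ (j - 1)) + (fst (snd h) *\<^sub>R P') * z ^ j
      + cnj (Q u * (of_nat k * fst h * z ^ (k - 1)) + (fst (snd h) *\<^sub>R Q') * z ^ k))) (at ?p)"
    unfolding F by (intro has_derivative_add has_derivative_cnj mono assms)
  note F' = frechet_derivative_at[OF this, symmetric]
  show "pderiv_coord 1 F ?p = of_nat j * P u * z ^ (j - 1)"
    and "pderiv_coord 2 F ?p = cnj (of_nat k * Q u * z ^ (k - 1))"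
    and "pderiv_coord 3 F ?p = P' * z ^ j + cnj (Q' * z ^ k)"
    and "pderiv_coord 4 F ?p = 0"
    unfolding pderiv_coord_def F' Let_def by (simp_all add: field_simps)
qed

section \<open>Metric, Christoffel symbols and curvature\<close>

lemma pp_metric_nth:
  "pp_metric f q $ a $ b =
    (if (a, b) \<in> {(1, 2), (2, 1)} then 1 else if (a, b) \<in> {(3, 4), (4, 3)} then -1
     else if (a, b) = (3, 3) then pp_metric f q $ 3 $ 3 else 0)"
  by (cases q) (auto simp: pp_metric_def)

text \<open>All index pairs except \<open>(3, 3)\<close>, where the rule would rewrite the entry to
  itself and loop.\<close>

lemmas pp_metric_entries =
  pp_metric_nth[of _ _ 1] pp_metric_nth[of _ _ 2] pp_metric_nth[of _ _ 4]
  pp_metric_nth[of _ _ 3 1] pp_metric_nth[of _ _ 3 2] pp_metric_nth[of _ _ 3 4]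

lemma matrix_inv_eqI:
  fixes A B :: "'a::semiring_1^'n^'n"
  assumes "A ** B = mat 1" "B ** A = mat 1"
  shows "matrix_inv A = B"
proof -
  have "A ** matrix_inv A = mat 1 \<and> matrix_inv A ** A = mat 1"
    unfolding matrix_inv_def by (rule someI[of _ B]) (simp add: assms)
  then have "matrix_inv A = (B ** A) ** matrix_inv A" "B ** (A ** matrix_inv A) = B"
    using assms by simp_all
  then show ?thesis by (simp add: matrix_mul_assoc)
qed

text \<open>In the block of the indices 3 and 4 the metric has rows \<open>(F, -1)\<close> and
  \<open>(-1, 0)\<close>, whose inverse has rows \<open>(0, -1)\<close> and \<open>(-1, -F)\<close>;
  the block of 1 and 2 is its own inverse.\<close>

lemma matrix_inv_pp_metric:
  "matrix_inv (pp_metric f q) = (\<chi> a b.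
     if (a, b) \<in> {(1, 2), (2, 1)} then 1 else if (a, b) \<in> {(3, 4), (4, 3)} then -1
     else if (a, b) = (4, 4) then - pp_metric f q $ 3 $ 3 else 0)"
  by (rule matrix_inv_eqI)
    (simp_all add: vec_eq_iff matrix_matrix_mult_def mat_def sum_4 forall_4 pp_metric_entries)

text \<open>The form of \<open>f\<close> is known only on \<open>D\<close>, so derivatives of the
  metric pass through congruence on an open set. \<open>E1\<close> enters the Christoffel symbols
  and \<open>E2\<close> their derivatives.\<close>

locale quadratic_pp_wave =
  fixes D :: "point set" and f :: "complex \<Rightarrow> real \<Rightarrow> complex" and E E1 E2 :: "real \<Rightarrow> complex"
  assumes open_D: "open D"
    and f_eq: "(z, u, v) \<in> D \<Longrightarrow> f z u = E u * z\<^sup>2"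
    and E_deriv: "u \<in> u_range D \<Longrightarrow> (E has_vector_derivative E1 u) (at u)"
    and E1_deriv: "u \<in> u_range D \<Longrightarrow> (E1 has_vector_derivative E2 u) (at u)"
begin

abbreviation g :: "point \<Rightarrow> complex^4^4" where "g \<equiv> pp_metric f"

lemma u_in_range: "(z, u, v) \<in> D \<Longrightarrow> u \<in> u_range D"
  by (force simp: u_range_def)

lemma pderiv_g33:
  assumes "(z, u, v) \<in> D"
  shows "pderiv_coord 1 (\<lambda>q. g q $ 3 $ 3) (z, u, v) = - 4 * E u * z"
    and "pderiv_coord 2 (\<lambda>q. g q $ 3 $ 3) (z, u, v) = - 4 * cnj (E u * z)"
    and "pderiv_coord 3 (\<lambda>q. g q $ 3 $ 3) (z, u, v) = - 2 * (E1 u * z\<^sup>2 + cnj (E1 u * z\<^sup>2))"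
    and "pderiv_coord 4 (\<lambda>q. g q $ 3 $ 3) (z, u, v) = 0"
proof -
  let ?F = "\<lambda>(z, u, v). (- 2 * E u) * z ^ 2 + cnj ((- 2 * E u) * z ^ 2)"
  have "((\<lambda>u. - 2 * E u) has_vector_derivative - 2 * E1 u) (at u)"
    by (rule has_vector_derivative_mult_right[OF E_deriv[OF u_in_range[OF assms]]])
  note D = pderiv_coord_monomial[OF this this, where j = 2 and k = 2 and z = z and v = v]
  have "g q $ 3 $ 3 = ?F q" if "q \<in> D" for q
    using f_eq that by (cases q) (simp add: pp_metric_def algebra_simps)
  note cong = pderiv_coord_cong_open[OF open_D assms this]
  show "pderiv_coord 1 (\<lambda>q. g q $ 3 $ 3) (z, u, v) = - 4 * E u * z"
    and "pderiv_coord 2 (\<lambda>q. g q $ 3 $ 3) (z, u, v) = - 4 * cnj (E u * z)"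
    and "pderiv_coord 3 (\<lambda>q. g q $ 3 $ 3) (z, u, v) = - 2 * (E1 u * z\<^sup>2 + cnj (E1 u * z\<^sup>2))"
    and "pderiv_coord 4 (\<lambda>q. g q $ 3 $ 3) (z, u, v) = 0"
    by (simp_all only: cong D) (simp_all add: algebra_simps)
qed

text \<open>Closed form of the Christoffel symbols on \<open>D\<close>. The index cases select whole
  functions of the point, so that each can be differentiated again by the monomial rule.\<close>

definition quad_christoffel :: "4 \<Rightarrow> 4 \<Rightarrow> 4 \<Rightarrow> point \<Rightarrow> complex" where
  "quad_christoffel a b c =
    (if (a, b, c) \<in> {(2, 3, 3), (4, 1, 3), (4, 3, 1)} then (\<lambda>(z, u, v). 2 * E u * z)
     else if (a, b, c) \<in> {(1, 3, 3), (4, 2, 3), (4, 3, 2)} then (\<lambda>(z, u, v). cnj (2 * E u * z))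
     else if (a, b, c) = (4, 3, 3) then (\<lambda>(z, u, v). E1 u * z\<^sup>2 + cnj (E1 u * z\<^sup>2))
     else (\<lambda>_. 0))"

lemma pderiv_g:
  assumes "(z, u, v) \<in> D"
  shows "pderiv_coord e (\<lambda>q. g q $ a $ b) (z, u, v) =
    (if (a, b) = (3, 3) then
       if e = 1 then - 4 * E u * z else if e = 2 then - 4 * cnj (E u * z)
       else if e = 3 then - 2 * (E1 u * z\<^sup>2 + cnj (E1 u * z\<^sup>2)) else 0
     else 0)"
proof (cases "(a, b) = (3, 3)")
  case True
  then show ?thesis using pderiv_g33[OF assms] exhaust_4[of e] by auto
next
  case False
  then have "g q $ a $ b = (if (a, b) \<in> {(1, 2), (2, 1)} then 1 else if (a, b) \<in> {(3, 4), (4, 3)} then -1 else 0)"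
    for q by (subst pp_metric_nth) (simp only: if_False)
  then show ?thesis
    using False by (subst pderiv_coord_zero_open[OF open_D assms]) auto
qed

lemma christoffel_eq:
  assumes "q \<in> D"
  shows "christoffel g q a b c = quad_christoffel a b c q"
proof -
  obtain z u v where q: "q = (z, u, v)" by (cases q)
  note d = pderiv_g[OF assms[unfolded q]]
  have "\<forall>a b c. christoffel g q a b c = quad_christoffel a b c q"
    unfolding forall_4 q christoffel_def sum_4 matrix_inv_pp_metric d by (simp add: quad_christoffel_def)
  then show ?thesis by blast
qed

lemma pderiv_quad_christoffel:
  assumes "(z, u, v) \<in> D"
  shows "pderiv_coord e (quad_christoffel a b c) (z, u, v) =
    (if (a, b, c) \<in> {(2, 3, 3), (4, 1, 3), (4, 3, 1)} then
       if e = 1 then 2 * E u else if e = 3 then 2 * E1 u * z else 0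
     else if (a, b, c) \<in> {(1, 3, 3), (4, 2, 3), (4, 3, 2)} then
       if e = 2 then cnj (2 * E u) else if e = 3 then cnj (2 * E1 u * z) else 0
     else if (a, b, c) = (4, 3, 3) then
       if e = 1 then 2 * E1 u * z else if e = 2 then cnj (2 * E1 u * z)
       else if e = 3 then E2 u * z\<^sup>2 + cnj (E2 u * z\<^sup>2) else 0
     else 0)"
proof -
  have E: "((\<lambda>u. 2 * E u) has_vector_derivative 2 * E1 u) (at u)"
    by (rule has_vector_derivative_mult_right[OF E_deriv[OF u_in_range[OF assms]]])
  have 0: "((\<lambda>u. 0::complex) has_vector_derivative 0) (at u)" by simp
  note E1 = E1_deriv[OF u_in_range[OF assms]]
  note d = pderiv_coord_monomial[OF E 0, where j = 1 and k = 0 and z = z and v = v]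
    pderiv_coord_monomial[OF 0 E, where j = 0 and k = 1 and z = z and v = v]
    pderiv_coord_monomial[OF E1 E1, where j = 2 and k = 2 and z = z and v = v]
  have "pderiv_coord e (\<lambda>(z, u, v). 2 * E u * z) (z, u, v) =
      (if e = 1 then 2 * E u else if e = 3 then 2 * E1 u * z else 0)"
    using exhaust_4[of e] d(1-4) by auto
  moreover have "pderiv_coord e (\<lambda>(z, u, v). cnj (2 * E u * z)) (z, u, v) =
      (if e = 2 then cnj (2 * E u) else if e = 3 then cnj (2 * E1 u * z) else 0)"
    using exhaust_4[of e] d(5-8) by auto
  moreover have "pderiv_coord e (\<lambda>(z, u, v). E1 u * z\<^sup>2 + cnj (E1 u * z\<^sup>2)) (z, u, v) =
      (if e = 1 then 2 * E1 u * z else if e = 2 then cnj (2 * E1 u * z)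
       else if e = 3 then E2 u * z\<^sup>2 + cnj (E2 u * z\<^sup>2) else 0)"
    using exhaust_4[of e] d(9-12) by auto
  ultimately show ?thesis
    unfolding quad_christoffel_def by (simp only: if_distrib[of "\<lambda>F. pderiv_coord e F (z, u, v)"] pderiv_coord_const)
qed

text \<open>Only \<open>E\<close> itself survives: for indices \<open>(4, 3, 1, 3)\<close> the two
  terms \<open>2 * E1 u * z\<close> cancel, likewise their conjugates, and \<open>E2\<close> occurs
  only for \<open>c = d = 3\<close>, where antisymmetry removes it.\<close>

lemma riemann_up_eq:
  assumes "q \<in> D"
  shows "riemann_up g q a b c d =
    (if (a, b, c, d) \<in> {(2, 3, 1, 3), (4, 1, 1, 3)} then 2 * E (fst (snd q))
     else if (a, b, c, d) \<in> {(2, 3, 3, 1), (4, 1, 3, 1)} then - 2 * E (fst (snd q))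
     else if (a, b, c, d) \<in> {(1, 3, 2, 3), (4, 2, 2, 3)} then 2 * cnj (E (fst (snd q)))
     else if (a, b, c, d) \<in> {(1, 3, 3, 2), (4, 2, 3, 2)} then - 2 * cnj (E (fst (snd q)))
     else 0)" (is "_ = ?R a b c d")
proof -
  obtain z u v where q: "q = (z, u, v)" by (cases q)
  have "pderiv_coord e (\<lambda>q. christoffel g q a b c) q = pderiv_coord e (quad_christoffel a b c) q" for e a b c
    by (rule pderiv_coord_cong_open[OF open_D assms]) (rule christoffel_eq)
  then have d: "pderiv_coord e (\<lambda>q. christoffel g q a b c) (z, u, v) = pderiv_coord e (quad_christoffel a b c) (z, u, v)"
    for e a b c by (simp add: q)
  \<comment> \<open>A nonzero product forces \<open>e\<close> to be 1 or 2, hence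
    \<open>a = 4\<close> and \<open>b = c = d = 3\<close>. It is therefore symmetric in
    \<open>c\<close> and \<open>d\<close>, and the quadratic part of the curvature cancels.\<close>
  have "quad_christoffel a c e q * quad_christoffel e d b q = quad_christoffel a d e q * quad_christoffel e c b q" for e
    using exhaust_4[of e] by (elim disjE) (simp_all add: quad_christoffel_def)
  then have "riemann_up g q a b c d = pderiv_coord c (quad_christoffel a d b) q - pderiv_coord d (quad_christoffel a c b) q"
    by (simp add: riemann_up_def christoffel_eq[OF assms] d[folded q])
  also have "\<dots> = ?R a b c d"
    unfolding q pderiv_quad_christoffel[OF assms[unfolded q]]
    using exhaust_4[of a] exhaust_4[of b] exhaust_4[of c] exhaust_4[of d]
    by (elim disjE) (simp_all)
  finally show ?thesis .
qed

text \<open>No nonzero component of \<open>riemann_up\<close> has equal first and third indices, so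
  the trace is empty; hence the Weyl tensor is the Riemann tensor.\<close>

lemma ricci_eq_0: "q \<in> D \<Longrightarrow> ricci g q b d = 0"
  using exhaust_4[of b] exhaust_4[of d]
  by (elim disjE) (simp_all add: ricci_def sum_4 riemann_up_eq)

lemma weyl_eq:
  assumes "q \<in> D"
  shows "weyl g q a b c d =
    (if (a, b, c, d) \<in> {(1, 3, 1, 3), (3, 1, 3, 1)} then 2 * E (fst (snd q))
     else if (a, b, c, d) \<in> {(1, 3, 3, 1), (3, 1, 1, 3)} then - 2 * E (fst (snd q))
     else if (a, b, c, d) \<in> {(2, 3, 2, 3), (3, 2, 3, 2)} then 2 * cnj (E (fst (snd q)))
     else if (a, b, c, d) \<in> {(2, 3, 3, 2), (3, 2, 2, 3)} then - 2 * cnj (E (fst (snd q)))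
     else 0)"
proof -
  have "weyl g q a b c d = riemann g q a b c d"
    by (simp add: weyl_def scalar_curv_def ricci_eq_0[OF assms])
  then show ?thesis
    unfolding riemann_def sum_4 riemann_up_eq[OF assms]
    using exhaust_4[of a] exhaust_4[of b] exhaust_4[of c] exhaust_4[of d]
    by (elim disjE) (simp_all add: pp_metric_entries)
qed

end

section \<open>Real directional derivatives and smoothness\<close>

lemma has_derivative_eq_on_open:
  assumes "open D" "p \<in> D" "\<And>q. q \<in> D \<Longrightarrow> F q = G q"
    and "(F has_derivative F') (at p)" "(G has_derivative G') (at p)"
  shows "F' h = G' h"
proof -
  have "(G has_derivative F') (at p)"
    using assms by (metis has_derivative_transform_within_open)
  then show ?thesis
    using assms(5) has_derivative_unique by blast
qed

text \<open>For a real vector the two Wirtinger terms combine into an ordinary directional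
  derivative, which makes the usual product and chain rules available for
  \<open>np_Delta\<close>.\<close>

lemma np_Delta_eq_frechet_derivative:
  assumes "F differentiable (at p)" "vec_cnj (n p) = n p"
  shows "np_Delta n F p = frechet_derivative F (at p) (n p $ 1, Re (n p $ 3), Re (n p $ 4))"
proof -
  let ?F = "frechet_derivative F (at p)" and ?X = "n p"
  have lin: "linear ?F"
    using assms(1) by (rule linear_frechet_derivative)
  have X: "?X $ 2 = cnj (?X $ 1)" "?X $ 3 = of_real (Re (?X $ 3))" "?X $ 4 = of_real (Re (?X $ 4))"
    using arg_cong[OF assms(2), of "\<lambda>X. X $ 2"] arg_cong[OF assms(2), of "\<lambda>X. X $ 3"]
      arg_cong[OF assms(2), of "\<lambda>X. X $ 4"]
    by (simp_all add: vec_cnj_def complex_eq_iff)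
  have "(?X $ 1, Re (?X $ 3), Re (?X $ 4)) = Re (?X $ 1) *\<^sub>R (1, 0, 0) + Im (?X $ 1) *\<^sub>R (\<i>, 0, 0)
      + Re (?X $ 3) *\<^sub>R (0, 1, 0) + Re (?X $ 4) *\<^sub>R ((0, 0, 1) :: point)"
    by (simp add: complex_eq_iff)
  then have 1: "?F (?X $ 1, Re (?X $ 3), Re (?X $ 4)) = Re (?X $ 1) *\<^sub>R ?F (1, 0, 0) + Im (?X $ 1) *\<^sub>R ?F (\<i>, 0, 0)
      + Re (?X $ 3) *\<^sub>R ?F (0, 1, 0) + Re (?X $ 4) *\<^sub>R ?F (0, 0, 1)"
    by (simp only: linear_add[OF lin] linear_scale[OF lin])
  have "?X $ 1 * ((x - \<i> * y) / 2) + ?X $ 2 * ((x + \<i> * y) / 2) = Re (?X $ 1) *\<^sub>R x + Im (?X $ 1) *\<^sub>R y" for x y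
    by (simp add: X(1) complex_eq_iff field_simps)
  moreover have "?X $ 3 * x = Re (?X $ 3) *\<^sub>R x" "?X $ 4 * x = Re (?X $ 4) *\<^sub>R x" for x
    by (subst X; simp add: scaleR_conv_of_real)+
  ultimately show ?thesis
    unfolding 1 np_Delta_def sum_4 pderiv_coord_def Let_def by simp
qed

lemma smooth_on_imp_differentiable:
  assumes "smooth_on S F" "x \<in> S"
  shows "F differentiable (at x)"
proof -
  have "Ck_on (Suc 0) S F"
    using assms(1) unfolding smooth_on_def by blast
  then show ?thesis
    using assms(2) by simp
qed

lemma smooth_on_vec_nth_differentiable:
  fixes F :: "'a::real_normed_vector \<Rightarrow> complex^'n"
  assumes "smooth_on S F" "x \<in> S"
  shows "(\<lambda>q. F q $ i) differentiable (at x)"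
  using smooth_on_imp_differentiable[OF assms] unfolding differentiable_def
  by (blast intro: bounded_linear.has_derivative[OF bounded_linear_vec_nth])

lemma smooth_on_zero: "smooth_on S (\<lambda>x. 0)"
proof -
  have "Ck_on k S (\<lambda>x. 0)" for k
    by (induction k) auto
  then show ?thesis unfolding smooth_on_def by blast
qed

lemma smooth_on_real_derivatives:
  fixes A :: "real \<Rightarrow> 'b::real_normed_vector"
  assumes "smooth_on S A" "x \<in> S"
  shows "(A has_vector_derivative frechet_derivative A (at x) 1) (at x)"
    and "(\<lambda>x. frechet_derivative A (at x) 1) differentiable (at x)"
proof -
  have "Ck_on (Suc (Suc 0)) S A"
    using assms(1) unfolding smooth_on_def by blast
  then show "(\<lambda>x. frechet_derivative A (at x) 1) differentiable (at x)"
    using assms(2) by auto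
  have d: "A differentiable (at x)"
    by (rule smooth_on_imp_differentiable[OF assms])
  have eq: "frechet_derivative A (at x) = (\<lambda>h. h *\<^sub>R frechet_derivative A (at x) 1)"
  proof
    show "frechet_derivative A (at x) h = h *\<^sub>R frechet_derivative A (at x) 1" for h
      using linear_scale[OF linear_frechet_derivative[OF d], of h 1] by simp
  qed
  show "(A has_vector_derivative frechet_derivative A (at x) 1) (at x)"
    unfolding has_vector_derivative_def
    by (rule has_derivative_eq_rhs[OF d[unfolded frechet_derivative_works] eq])
qed


section \<open>Null tetrads aligned with the constant null vector\<close>

lemma inner_g_pp_metric:
  "inner_g (pp_metric f q) X Y = X $ 1 * Y $ 2 + X $ 2 * Y $ 1 - X $ 3 * Y $ 4 - X $ 4 * Y $ 3
    + pp_metric f q $ 3 $ 3 * X $ 3 * Y $ 3"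
  unfolding inner_g_def sum_4 by (simp add: pp_metric_entries)

lemma lower_pp_metric:
  "lower (pp_metric f) X a q = (if a = 1 then X q $ 2 else if a = 2 then X q $ 1
    else if a = 3 then pp_metric f q $ 3 $ 3 * X q $ 3 - X q $ 4 else - X q $ 3)"
  using exhaust_4[of a] unfolding lower_def sum_4 by (elim disjE) (simp_all add: pp_metric_entries)

text \<open>Since the conjugate of \<open>m\<close> has no component 3, only the Weyl components
  \<open>(3, 1, 3, 1)\<close> and \<open>(3, 2, 3, 2)\<close> contribute. Conjugation swaps the
  frame vectors 1 and 2, so \<open>E\<close> is paired with \<open>m $ 2\<close> and its conjugate
  with \<open>m $ 1\<close>.\<close>

lemma (in quadratic_pp_wave) np_Psi4_eq:
  assumes "q \<in> D" "m q $ 3 = 0"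
  shows "np_Psi4 g n m q =
    2 * (n q $ 3)\<^sup>2 * (E (fst (snd q)) * (cnj (m q $ 2))\<^sup>2 + cnj (E (fst (snd q))) * (cnj (m q $ 1))\<^sup>2)"
proof -
  have "vec_cnj (m q) $ 3 = 0"
    by (simp add: vec_cnj_def assms)
  then show ?thesis
    unfolding np_Psi4_def sum_4
    by (simp add: weyl_eq[OF assms(1)]) (simp add: vec_cnj_def power2_eq_square algebra_simps)
qed

locale psi4_tetrad = quadratic_pp_wave +
  fixes l n m :: "point \<Rightarrow> complex^4"
  assumes null: "null_tetrad D g l n m"
    and aligned: "aligned_tetrad D l"
    and Psi4: "q \<in> D \<Longrightarrow> np_Psi4 g n m q = 1"
begin

lemma l_components:
  assumes "q \<in> D"
  shows "l q $ 1 = 0" "l q $ 2 = 0" "l q $ 3 = 0" "l q $ 4 = of_real (Re (l q $ 4))"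
proof -
  obtain B where "l q = B *s axis 4 1"
    using aligned assms by (auto simp: aligned_tetrad_def)
  then show "l q $ 1 = 0" "l q $ 2 = 0" "l q $ 3 = 0"
    by (simp_all add: axis_def)
  have "vec_cnj (l q) $ 4 = l q $ 4"
    using null assms by (simp add: null_tetrad_def)
  then show "l q $ 4 = of_real (Re (l q $ 4))"
    by (simp add: vec_cnj_def complex_eq_iff)
qed

text \<open>Orthogonality to \<open>l\<close> removes the third component of \<open>m\<close>;
  nullity of \<open>m\<close> then makes one of its first two components vanish, and the
  normalization makes the other unimodular. Both orientations are possible.\<close>

lemma tetrad_components:
  assumes "q \<in> D"
  shows "l q $ 4 \<noteq> 0" "n q $ 3 = 1 / l q $ 4" "m q $ 3 = 0" "m q $ 1 * m q $ 2 = 0"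
    "m q $ 1 * cnj (m q $ 1) + m q $ 2 * cnj (m q $ 2) = 1"
proof -
  have "inner_g (g q) (l q) (n q) = - 1" "inner_g (g q) (l q) (m q) = 0" "inner_g (g q) (m q) (m q) = 0"
    "inner_g (g q) (m q) (vec_cnj (m q)) = 1"
    using null assms by (simp_all add: null_tetrad_def)
  note i = this[unfolded inner_g_pp_metric l_components(1-3)[OF assms], simplified]
  show l4: "l q $ 4 \<noteq> 0"
    using i(1) by auto
  show "n q $ 3 = 1 / l q $ 4" and m3: "m q $ 3 = 0"
    using i(1,2) l4 by (auto simp: field_simps)
  show "m q $ 1 * m q $ 2 = 0" 
    "m q $ 1 * cnj (m q $ 1) + m q $ 2 * cnj (m q $ 2) = 1"
    using i(3,4) m3 by (auto simp: vec_cnj_def)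
qed

lemma l4_square:
  assumes "q \<in> D"
  shows "(l q $ 4)\<^sup>2 = 2 * (E (fst (snd q)) * (cnj (m q $ 2))\<^sup>2 + cnj (E (fst (snd q))) * (cnj (m q $ 1))\<^sup>2)"
  using Psi4[OF assms] np_Psi4_eq[where m = m and n = n, OF assms] tetrad_components[OF assms]
  by (simp add: field_simps)

lemma tetrad_differentiable:
  assumes "q \<in> D"
  shows "(\<lambda>q. l q $ a) differentiable (at q)" "(\<lambda>q. m q $ a) differentiable (at q)"
  using null assms by (auto simp: null_tetrad_def intro: smooth_on_vec_nth_differentiable)

text \<open>The connection terms drop out. The lowered \<open>l\<close> has only component 3, but no
  Christoffel symbol has upper index 3. For indices 1 and 2 of \<open>m\<close> only the upper index
  4 occurs, and the lowered \<open>m\<close> vanishes there; index 3 is contracted with the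
  vanishing third component of the conjugate of \<open>m\<close>.\<close>

lemma np_gamma_eq_np_Delta:
  assumes "p \<in> D"
  shows "np_gamma g l n m p = (np_Delta n (\<lambda>q. l q $ 4) p / l p $ 4
    + cnj (m p $ 1) * np_Delta n (\<lambda>q. m q $ 1) p + cnj (m p $ 2) * np_Delta n (\<lambda>q. m q $ 2) p) / 2"
proof -
  have minus: "pderiv_coord b (\<lambda>q. - l q $ 4) p = - pderiv_coord b (\<lambda>q. l q $ 4) p" for b
  proof -
    note d = tetrad_differentiable(1)[OF assms, where a = 4, unfolded frechet_derivative_works]
    show ?thesis
      unfolding pderiv_coord_def frechet_derivative_at[OF has_derivative_minus[OF d], symmetric]
      by (simp add: Let_def field_simps)
  qed
  have l1: "cov_deriv g l a b p = pderiv_coord b (lower g l a) p" for a b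
    unfolding cov_deriv_def sum_4 lower_pp_metric christoffel_eq[OF assms]
    by (simp add: quad_christoffel_def l_components(1-3)[OF assms])
  have l2: "cov_deriv g l 3 b p = - pderiv_coord b (\<lambda>q. l q $ 4) p" for b
    unfolding l1 minus[symmetric]
    by (rule pderiv_coord_cong_open[OF open_D assms]) (simp add: lower_pp_metric l_components(1-3))
  have l3: "cov_deriv g l a b p = 0" if "a \<noteq> 3" for a b
    unfolding l1 using that
    by (intro pderiv_coord_zero_open[OF open_D assms, where c = 0]) (simp add: lower_pp_metric l_components(1-3))
  have m1: "cov_deriv g m 1 b p = pderiv_coord b (\<lambda>q. m q $ 2) p"
    "cov_deriv g m 2 b p = pderiv_coord b (\<lambda>q. m q $ 1) p" for b
    unfolding cov_deriv_def sum_4 lower_pp_metric[abs_def] christoffel_eq[OF assms]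
    by (simp_all add: quad_christoffel_def tetrad_components[OF assms])
  have "pderiv_coord b (lower g m 4) p = 0" for b
    by (intro pderiv_coord_zero_open[OF open_D assms, where c = 0]) (simp add: lower_pp_metric tetrad_components)
  then have m2: "cov_deriv g m 4 b p = 0" for b
    unfolding cov_deriv_def sum_4 christoffel_eq[OF assms] by (simp add: quad_christoffel_def)
  show ?thesis
    unfolding np_gamma_def np_Delta_def sum_4
    by (simp add: l2 l3 m1 m2 vec_cnj_def tetrad_components[OF assms] field_simps)
qed

end

text \<open>Here \<open>b = B\<close>, \<open>x\<close> is the derivative of \<open>B\<close> along \<open>n\<close>, \<open>w\<close> is the conjugate of the nonzero
  component \<open>m\<close>, and \<open>d'\<close>, \<open>d\<close> are the derivatives of that component and of its conjugate.\<close>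

lemma square_derivative_solve:
  fixes a b d d' e m w x :: complex
  assumes "b \<noteq> 0" "b\<^sup>2 = 2 * e * w\<^sup>2" "m * w = 1" "b * x = 4 * a * e * w\<^sup>2 / b + 2 * e * w * d"
    and "d' * w + m * d = 0"
  shows "x / b + w * d' = 2 * a / b"
proof -
  have "2 * e * w * d = 2 * e * w * (m * w) * d"
    using assms(3) by simp
  also have "\<dots> = b\<^sup>2 * (m * d)"
    by (simp only: assms(2)) (simp add: power2_eq_square mult_ac)
  finally have "b * x = 4 * a * e * w\<^sup>2 / b + b\<^sup>2 * (m * d)"
    using assms(4) by simp
  moreover have "2 * a / b * b\<^sup>2 = 4 * a * e * w\<^sup>2 / b"
    by (simp only: assms(2)) simp
  ultimately have "b * x = 2 * a / b * b\<^sup>2 + b\<^sup>2 * (m * d)"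
    by (simp only:)
  then have "b * x = b * (b * (2 * a / b + m * d))"
    by (simp add: power2_eq_square algebra_simps)
  then have "x = b * (2 * a / b + m * d)"
    using assms(1) by simp
  then have "x / b = 2 * a / b + m * d"
    using assms(1) by simp
  moreover have "w * d' = - (m * d)"
    using assms(5) by (simp add: add_eq_0_iff2 mult.commute)
  ultimately show ?thesis by simp
qed

section \<open>The spin coefficient gamma and its constancy\<close>

context psi4_tetrad
begin

lemma fst_snd_in_u_range: "q \<in> D \<Longrightarrow> fst (snd q) \<in> u_range D"
  by (cases q) (simp add: u_in_range)

lemma real_n3:
  assumes "q \<in> D"
  shows "vec_cnj (n q) = n q" "of_real (Re (n q $ 3)) = 1 / l q $ 4"
proof -
  show "vec_cnj (n q) = n q"
    using null assms by (simp add: null_tetrad_def)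
  show "of_real (Re (n q $ 3)) = 1 / l q $ 4"
    using tetrad_components(2)[OF assms] l_components(4)[OF assms]
    by (metis Re_complex_of_real of_real_1 of_real_divide)
qed

text \<open>Differentiating \<open>l4_square\<close> and the normalization of \<open>m\<close> along
  \<open>n\<close> yields two linear relations, which together determine the combination of
  derivatives in \<open>np_gamma_eq_np_Delta\<close>. Here \<open>a\<close> plays the role of the
  derivative of \<open>A\<close>.\<close>

lemma np_gamma_eq:
  assumes "p \<in> D" and a: "E1 (fst (snd p)) = 4 * a * E (fst (snd p))"
  shows "np_gamma g l n m p = (if m p $ 2 = 0 then cnj a else a) / l p $ 4"
proof -
  let ?u = "fst (snd p)" and ?X = "(n p $ 1, Re (n p $ 3), Re (n p $ 4))"
  note comp = tetrad_components[OF assms(1)]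
  define B M1 M2 where "B = frechet_derivative (\<lambda>q. l q $ 4) (at p)"
    and "M1 = frechet_derivative (\<lambda>q. m q $ 1) (at p)" and "M2 = frechet_derivative (\<lambda>q. m q $ 2) (at p)"
  have B: "((\<lambda>q. l q $ 4) has_derivative B) (at p)"
    and M1: "((\<lambda>q. m q $ 1) has_derivative M1) (at p)" and M2: "((\<lambda>q. m q $ 2) has_derivative M2) (at p)"
    using tetrad_differentiable[OF assms(1)] by (simp_all add: B_def M1_def M2_def frechet_derivative_works[symmetric])
  have E: "((\<lambda>q. E (fst (snd q))) has_derivative (\<lambda>h. fst (snd h) *\<^sub>R E1 ?u)) (at p)"
    by (rule has_derivative_u[OF E_deriv[OF fst_snd_in_u_range[OF assms(1)]]])
  note cE = has_derivative_cnj[OF E] and cM1 = has_derivative_cnj[OF M1] and cM2 = has_derivative_cnj[OF M2]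
  \<comment> \<open>Half of \<open>l4_square\<close> differentiated along \<open>n\<close>. The
    denominators come from the \<open>u\<close>-component of \<open>n\<close>, which is
    \<open>1 / l p $ 4\<close>.\<close>
  have sq: "(l p $ 4) * B ?X = E1 ?u / l p $ 4 * (cnj (m p $ 2))\<^sup>2 + 2 * E ?u * cnj (m p $ 2) * cnj (M2 ?X)
      + cnj (E1 ?u) / l p $ 4 * (cnj (m p $ 1))\<^sup>2 + 2 * cnj (E ?u) * cnj (m p $ 1) * cnj (M1 ?X)"
  proof -
    have L: "((\<lambda>q. l q $ 4 * l q $ 4) has_derivative (\<lambda>h. l p $ 4 * B h + B h * l p $ 4)) (at p)"
      by (rule has_derivative_mult[OF B B])
    have R: "((\<lambda>q. 2 * (E (fst (snd q)) * (cnj (m q $ 2) * cnj (m q $ 2))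
          + cnj (E (fst (snd q))) * (cnj (m q $ 1) * cnj (m q $ 1)))) has_derivative
        (\<lambda>h. 2 * ((E ?u * (cnj (m p $ 2) * cnj (M2 h) + cnj (M2 h) * cnj (m p $ 2))
            + (fst (snd h) *\<^sub>R E1 ?u) * (cnj (m p $ 2) * cnj (m p $ 2)))
          + (cnj (E ?u) * (cnj (m p $ 1) * cnj (M1 h) + cnj (M1 h) * cnj (m p $ 1))
            + cnj (fst (snd h) *\<^sub>R E1 ?u) * (cnj (m p $ 1) * cnj (m p $ 1)))))) (at p)"
      by (intro has_derivative_mult_right has_derivative_add has_derivative_mult E cE cM1 cM2)
    have "l q $ 4 * l q $ 4 = 2 * (E (fst (snd q)) * (cnj (m q $ 2) * cnj (m q $ 2))
          + cnj (E (fst (snd q))) * (cnj (m q $ 1) * cnj (m q $ 1)))" if "q \<in> D" for q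
      using l4_square[OF that] by (simp add: power2_eq_square)
    from has_derivative_eq_on_open[OF open_D assms(1) this L R, of ?X]
    moreover have "cnj (l p $ 4) = l p $ 4"
      by (subst (1 2) l_components(4)[OF assms(1)]) simp
    ultimately show ?thesis
      unfolding fst_conv snd_conv scaleR_conv_of_real real_n3(2)[OF assms(1)]
      by - (rule mult_left_cancel[of 2, THEN iffD1], simp_all add: power2_eq_square algebra_simps)
  qed
  have un: "m p $ 1 * cnj (M1 ?X) + M1 ?X * cnj (m p $ 1) + (m p $ 2 * cnj (M2 ?X) + M2 ?X * cnj (m p $ 2)) = 0"
    by (rule has_derivative_eq_on_open[OF open_D assms(1) tetrad_components(5)
        has_derivative_add[OF has_derivative_mult[OF M1 cM1] has_derivative_mult[OF M2 cM2]]
        has_derivative_const])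
  have "2 * np_gamma g l n m p = B ?X / l p $ 4 + cnj (m p $ 1) * M1 ?X + cnj (m p $ 2) * M2 ?X"
    unfolding np_gamma_eq_np_Delta[OF assms(1)]
    by (simp add: np_Delta_eq_frechet_derivative tetrad_differentiable[OF assms(1)] real_n3[OF assms(1)]
        B_def M1_def M2_def)
  also have "\<dots> = 2 * ((if m p $ 2 = 0 then cnj a else a) / l p $ 4)"
  proof (cases "m p $ 2 = 0")
    case True
    \<comment> \<open>In this orientation the square relation contains only the conjugate of
      \<open>E\<close>, so its logarithmic derivative supplies \<open>cnj a\<close>.\<close>
    have "B ?X / l p $ 4 + cnj (m p $ 1) * M1 ?X = 2 * cnj a / l p $ 4"
      by (rule square_derivative_solve[where e = "cnj (E ?u)" and m = "m p $ 1" and d = "cnj (M1 ?X)"])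
        (use True comp l4_square[OF assms(1)] sq un a in \<open>simp_all add: algebra_simps\<close>)
    then show ?thesis using True by simp
  next
    case False
    then have "m p $ 1 = 0" using comp(4) by simp
    have "B ?X / l p $ 4 + cnj (m p $ 2) * M2 ?X = 2 * a / l p $ 4"
      by (rule square_derivative_solve[where e = "E ?u" and m = "m p $ 2" and d = "cnj (M2 ?X)"])
        (use \<open>m p $ 1 = 0\<close> comp l4_square[OF assms(1)] sq un a in \<open>simp_all add: algebra_simps\<close>)
    then show ?thesis using False \<open>m p $ 1 = 0\<close> by simp
  qed
  finally show ?thesis
    by (rule mult_left_cancel[THEN iffD1, rotated]) simp
qed

text \<open>Norms remove all phases: the surviving component of \<open>m\<close> is unimodular, and
  the square of the real number \<open>l q $ 4\<close> is the square of its norm.\<close>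

lemma l4_square_norm:
  assumes "q \<in> D"
  shows "(l q $ 4)\<^sup>2 = of_real (2 * norm (E (fst (snd q))))"
proof -
  let ?e = "E (fst (snd q))"
  have "norm (l q $ 4) ^ 2 = 2 * norm ?e"
  proof (cases "m q $ 2 = 0")
    case True
    then have "norm (m q $ 1 * cnj (m q $ 1)) = 1"
      using tetrad_components(5)[OF assms] by simp
    then show ?thesis
      using True arg_cong[OF l4_square[OF assms], of norm]
      by (simp add: norm_mult norm_power power2_eq_square)
  next
    case False
    then have "m q $ 1 = 0" using tetrad_components(4)[OF assms] by simp
    then have "norm (m q $ 2 * cnj (m q $ 2)) = 1"
      using tetrad_components(5)[OF assms] by simp
    then show ?thesis
      using \<open>m q $ 1 = 0\<close> arg_cong[OF l4_square[OF assms], of norm]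
      by (simp add: norm_mult norm_power power2_eq_square)
  qed
  moreover have "(l q $ 4)\<^sup>2 = of_real (norm (l q $ 4) ^ 2)"
    by (subst (1 2) l_components(4)[OF assms]) (simp only: norm_of_real power2_abs of_real_power)
  ultimately show ?thesis by simp
qed

text \<open>Near \<open>p\<close> gamma is given by one formula \<open>c (A1 u) / l $ 4\<close>,
  with \<open>c\<close> either conjugation or the identity. The derivative of
  \<open>2 * gamma^2 = (c K)^2\<close> along \<open>n\<close> vanishes on the left, while on the
  right \<open>c K\<close> and the \<open>u\<close>-component of \<open>n\<close> are nonzero, which
  forces the derivative of \<open>K\<close> to vanish.\<close>

lemma has_vector_derivative_zero_if_np_Delta_zero:
  fixes A A1 K :: "real \<Rightarrow> complex"
  defines "K \<equiv> \<lambda>u. A1 u * of_real (exp (- 2 * Re (A u)))"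
  assumes p: "p \<in> D"
    and E: "\<And>u. u \<in> u_range D \<Longrightarrow> E u = exp (4 * A u)"
    and E1: "\<And>u. u \<in> u_range D \<Longrightarrow> E1 u = 4 * A1 u * E u"
    and A: "A differentiable (at (fst (snd p)))" and A1: "A1 differentiable (at (fst (snd p)))"
    and Delta: "np_Delta n (np_gamma g l n m) p = 0" and gamma: "np_gamma g l n m p \<noteq> 0"
  shows "(K has_vector_derivative 0) (at (fst (snd p)))"
proof -
  let ?u = "fst (snd p)" and ?X = "(n p $ 1, Re (n p $ 3), Re (n p $ 4))"
  obtain A' where A': "(A has_vector_derivative A') (at ?u)"
    using A vector_derivative_works by blast
  obtain A1' where A1': "(A1 has_vector_derivative A1') (at ?u)"
    using A1 vector_derivative_works by blast
  have "((\<lambda>u. Re (A u)) has_real_derivative Re A') (at ?u)"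
    using bounded_linear.has_vector_derivative[OF bounded_linear_Re A']
    by (simp add: has_real_derivative_iff_has_vector_derivative)
  then have "((\<lambda>u. exp (- 2 * Re (A u))) has_real_derivative exp (- 2 * Re (A ?u)) * (- 2 * Re A')) (at ?u)"
    by (intro DERIV_fun_exp DERIV_cmult)
  from has_vector_derivative_mult[OF A1' has_vector_derivative_of_real[OF this]]
  obtain K' where K': "(K has_vector_derivative K') (at ?u)"
    unfolding K_def by blast
  have K'0: "c K' = 0"
    if U: "open U" "p \<in> U" "U \<subseteq> D" and \<gamma>: "\<And>q. q \<in> U \<Longrightarrow> np_gamma g l n m q = c (A1 (fst (snd q))) / l q $ 4"
      and c: "c = cnj \<or> c = id" for U and c :: "complex \<Rightarrow> complex"
  proof -
    have bl: "bounded_linear c" using c bounded_linear_cnj bounded_linear_ident by (auto simp: id_def)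
    have c_mult: "c (x * of_real r) = c x * of_real r" for x r using c by auto
    obtain B where B: "((\<lambda>q. l q $ 4) has_derivative B) (at p)"
      using tetrad_differentiable(1)[OF p] unfolding differentiable_def by blast
    note l4 = tetrad_components(1)[OF p]
    have "((\<lambda>q. c (A1 (fst (snd q)))) has_derivative (\<lambda>h. fst (snd h) *\<^sub>R c A1')) (at p)"
      by (rule has_derivative_u[OF bounded_linear.has_vector_derivative[OF bl A1']])
    from has_derivative_divide[OF this B l4]
    obtain G' where G': "((\<lambda>q. c (A1 (fst (snd q))) / l q $ 4) has_derivative G') (at p)"
      by blast
    let ?\<gamma> = "np_gamma g l n m"
    \<comment> \<open>Differentiability of gamma is obtained from its formula on
      \<open>U\<close>.\<close>
    have d\<gamma>: "(?\<gamma> has_derivative G') (at p)"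
      by (rule has_derivative_transform_within_open[OF G' U(1,2)]) (simp add: \<gamma>)
    then have "G' ?X = 0"
      using np_Delta_eq_frechet_derivative[where n = n, OF differentiableI[OF d\<gamma>] real_n3(1)[OF p]] Delta
      by (simp add: frechet_derivative_at[symmetric])
    \<comment> \<open>Squaring removes the undetermined sign of \<open>l q $ 4\<close>:
      \<open>l4_square_norm\<close> gives \<open>2 / (l q $ 4)^2 = exp (- 4 * Re A)\<close>.\<close>
    have "2 * (?\<gamma> q * ?\<gamma> q) = c (K (fst (snd q))) * c (K (fst (snd q)))" if "q \<in> U" for q
    proof -
      have "q \<in> D" using that U(3) by blast
      define x where "x = exp (- 2 * Re (A (fst (snd q))))"
      have "exp (4 * Re (A (fst (snd q)))) = inverse (x * x)" "x \<noteq> 0"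
        by (simp_all add: x_def exp_minus flip: exp_add)
      then have "(l q $ 4)\<^sup>2 = of_real (2 * inverse (x * x))"
        using l4_square_norm[OF \<open>q \<in> D\<close>] E[OF fst_snd_in_u_range[OF \<open>q \<in> D\<close>]] by simp
      then have "2 / (l q $ 4)\<^sup>2 = of_real (2 / (2 * inverse (x * x)))"
        by (simp only: of_real_divide of_real_numeral)
      moreover have "2 / (2 * inverse (x * x)) = x * x"
        using \<open>x \<noteq> 0\<close> by (simp add: field_simps)
      ultimately have x: "2 / (l q $ 4)\<^sup>2 = of_real x * of_real x"
        by (simp only: of_real_mult)
      have y: "2 * (y / l q $ 4 * (y / l q $ 4)) = y * y * (of_real x * of_real x)" for y
        unfolding x[symmetric] by (simp add: power2_eq_square)
      show ?thesis
        unfolding \<gamma>[OF that] y K_def c_mult x_def[symmetric] by (simp only: mult_ac)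
    qed
    note eq = has_derivative_eq_on_open[OF U(1,2) this has_derivative_mult_right[OF has_derivative_mult[OF d\<gamma> d\<gamma>]]
      has_derivative_mult[OF has_derivative_u[OF bounded_linear.has_vector_derivative[OF bl K']]
        has_derivative_u[OF bounded_linear.has_vector_derivative[OF bl K']]], of ?X]
    have "c (K ?u) \<noteq> 0"
      using gamma l4 unfolding \<gamma>[OF U(2)] K_def c_mult by simp
    moreover have "Re (n p $ 3) \<noteq> 0"
      using real_n3(2)[OF p] l4 by (metis divide_eq_0_iff of_real_0 one_neq_zero)
    ultimately show "c K' = 0"
      using eq \<open>G' ?X = 0\<close> by (simp add: scaleR_conv_of_real)
  qed
  \<comment> \<open>One component of \<open>m\<close> vanishes exactly where the other does not.
    Around \<open>p\<close> the nonvanishing one stays nonzero on an open set, and this fixes the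
    branch of the formula for gamma there.\<close>
  have open_nonzero: "open (D \<inter> (\<lambda>q. m q $ a) -` (- {0}))" for a
  proof (rule continuous_open_preimage[OF _ open_D])
    show "continuous_on D (\<lambda>q. m q $ a)"
      using tetrad_differentiable(2)[where a = a]
      by (auto intro!: continuous_at_imp_continuous_on differentiable_imp_continuous_within)
  qed auto
  have \<gamma>: "np_gamma g l n m q = (if m q $ 2 = 0 then cnj (A1 (fst (snd q))) else A1 (fst (snd q))) / l q $ 4"
    if "q \<in> D" for q
    by (rule np_gamma_eq[OF that E1[OF fst_snd_in_u_range[OF that]]])
  have "K' = 0"
  proof (cases "m p $ 2 = 0")
    case True
    have "cnj K' = 0"
    proof (rule K'0[OF open_nonzero[of 1]])
      show "p \<in> D \<inter> (\<lambda>q. m q $ 1) -` (- {0})"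
        using True p tetrad_components(5)[OF p] by auto
      show "np_gamma g l n m q = cnj (A1 (fst (snd q))) / l q $ 4" if "q \<in> D \<inter> (\<lambda>q. m q $ 1) -` (- {0})" for q
        using that \<gamma>[of q] tetrad_components(4)[of q] by auto
    qed auto
    then show ?thesis by simp
  next
    case False
    have "id K' = 0"
    proof (rule K'0[OF open_nonzero[of 2]])
      show "p \<in> D \<inter> (\<lambda>q. m q $ 2) -` (- {0})"
        using False p by auto
      show "np_gamma g l n m q = id (A1 (fst (snd q))) / l q $ 4" if "q \<in> D \<inter> (\<lambda>q. m q $ 2) -` (- {0})" for q
        using that \<gamma>[of q] by auto
    qed auto
    then show ?thesis by simp
  qed
  then show ?thesis using K' by simp
qed

end

section \<open>Solving the differential equation for \<open>A\<close>\<close>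

lemma ode_solution:
  fixes A A1 :: "real \<Rightarrow> complex" and I :: "real set" and K :: complex
  assumes "open I" "connected I"
    and A: "\<And>u. u \<in> I \<Longrightarrow> (A has_vector_derivative A1 u) (at u)"
    and A1: "\<And>u. u \<in> I \<Longrightarrow> A1 u = K * of_real (exp (2 * Re (A u)))"
    and K: "Re K \<noteq> 0"
  obtains s u0 \<theta> where "s = 1 \<or> s = - 1"
    and "\<And>u. u \<in> I \<Longrightarrow> s * (u + u0) > 0 \<and> exp (4 * A u) = of_real (1 / (4 * (Re K)\<^sup>2)) * cis \<theta> *
        of_real (s * (u + u0)) powr (2 * \<i> * of_real (- Im K / Re K) - 2)"
proof -
  \<comment> \<open>The sign \<open>s\<close> is that of the slope \<open>- 2 * k\<close> of
    \<open>exp (- 2 * Re A)\<close>, so that \<open>s * (u + u0)\<close> will be a positive multiple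
    of this function.\<close>
  define k k0 s where "k = Re K" and "k0 = - Im K / Re K" and "s = - sgn (Re K)"
  have sk: "- 2 * k = 2 * \<bar>k\<bar> * s" "s = 1 \<or> s = - 1" "k \<noteq> 0" "\<bar>k\<bar> > 0"
    using K by (auto simp: k_def s_def sgn_if)
  define r i where "r u = Re (A u)" and "i u = Im (A u)" for u
  have Re: "(r has_real_derivative k * exp (2 * r u)) (at u)"
    and Im: "(i has_real_derivative Im K * exp (2 * r u)) (at u)" if "u \<in> I" for u
    using bounded_linear.has_vector_derivative[OF bounded_linear_Re A[OF that]]
      bounded_linear.has_vector_derivative[OF bounded_linear_Im A[OF that]] A1[OF that]
    by (simp_all add: has_real_derivative_iff_has_vector_derivative k_def r_def[abs_def] i_def[abs_def])
  have 1: "((\<lambda>u. exp (- 2 * r u) + 2 * k * u) has_real_derivative 0) (at u)" if "u \<in> I" for u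
    by (rule derivative_eq_intros Re[OF that] refl)+ (simp add: exp_minus field_simps)
  obtain C where C: "\<And>u. u \<in> I \<Longrightarrow> exp (- 2 * r u) + 2 * k * u = C"
    using has_field_derivative_0_imp_constant_on[OF 1 assms(2,1)] by (auto simp: constant_on_def)
  \<comment> \<open>The derivatives of \<open>i\<close> and \<open>r\<close> have the constant ratio
    \<open>Im K / Re K = - k0\<close>.\<close>
  have 2: "((\<lambda>u. i u + k0 * r u) has_real_derivative 0) (at u)" if "u \<in> I" for u
    by (rule derivative_eq_intros Re[OF that] Im[OF that] refl)+ (use K in \<open>simp add: k0_def k_def\<close>)
  obtain c where c: "\<And>u. u \<in> I \<Longrightarrow> i u + k0 * r u = c"
    using has_field_derivative_0_imp_constant_on[OF 2 assms(2,1)] by (auto simp: constant_on_def)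
  \<comment> \<open>\<open>- u0\<close> is the zero of the affine function
    \<open>C - 2 * k * u\<close>, and \<theta> is the constant left when \<open>4 * Im A\<close> is
    written in terms of \<open>ln (s * (u + u0))\<close>.\<close>
  define u0 \<theta> where "u0 = - C / (2 * k)" and "\<theta> = 4 * c + 2 * k0 * ln (2 * \<bar>k\<bar>)"
  have "s * (u + u0) > 0 \<and> exp (4 * A u) = of_real (1 / (4 * (Re K)\<^sup>2)) * cis \<theta> *
        of_real (s * (u + u0)) powr (2 * \<i> * of_real (- Im K / Re K) - 2)" if "u \<in> I" for u
  proof
    let ?w = "s * (u + u0)"
    have "2 * \<bar>k\<bar> * ?w = - 2 * k * (u + u0)"
      using sk(1) by (metis mult.assoc)
    also have "\<dots> = exp (- 2 * r u)"
      using sk(3) by (simp add: u0_def C[OF that, symmetric] field_simps)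
    finally have w: "2 * \<bar>k\<bar> * ?w = exp (- 2 * r u)" .
    then have "2 * \<bar>k\<bar> * ?w > 0" by simp
    then show w0: "?w > 0"
      using sk(4) by (simp add: zero_less_mult_iff)
    have lnw: "ln ?w = - 2 * r u - ln (2 * \<bar>k\<bar>)"
      using arg_cong[OF w, of ln] w0 sk(4) by (simp add: ln_mult_pos)
    have 3: "of_real (1 / (4 * (Re K)\<^sup>2)) = exp (of_real (- 2 * ln (2 * \<bar>k\<bar>)) :: complex)"
    proof -
      have "exp (- 2 * ln (2 * \<bar>k\<bar>)) = inverse ((exp (ln (2 * \<bar>k\<bar>)))\<^sup>2)"
        by (simp add: exp_minus exp_double)
      also have "\<dots> = 1 / (4 * (Re K)\<^sup>2)"
        using sk(4) by (simp add: k_def power_mult_distrib inverse_eq_divide)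
      finally show ?thesis by (simp only: exp_of_real)
    qed
    have "Re (A u) = r u" "Im (A u) = c - k0 * r u"
      using c[OF that] by (simp_all add: r_def i_def)
    then have "4 * A u = of_real (- 2 * ln (2 * \<bar>k\<bar>)) + \<i> * of_real \<theta> + (2 * \<i> * of_real k0 - 2) * of_real (ln ?w)"
      unfolding lnw by (simp add: complex_eq_iff \<theta>_def algebra_simps)
    then have "exp (4 * A u) = exp (of_real (- 2 * ln (2 * \<bar>k\<bar>))) * exp (\<i> * of_real \<theta>)
        * exp ((2 * \<i> * of_real k0 - 2) * of_real (ln ?w))"
      by (simp only: exp_add)
    moreover have "of_real ?w powr z = exp (z * of_real (ln ?w))" for z :: complex
      using w0 by (auto simp: powr_def Ln_of_real simp del: of_real_mult of_real_add)
    ultimately show "exp (4 * A u) = of_real (1 / (4 * (Re K)\<^sup>2)) * cis \<theta> *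
        of_real ?w powr (2 * \<i> * of_real (- Im K / Re K) - 2)"
      unfolding 3 k0_def[symmetric] by (simp only: cis_conv_exp)
  qed
  with that[OF sk(2)] show ?thesis by blast
qed

section \<open>Normalization by a change of coordinates\<close>

lemma vacuum_pp_wave_u_range:
  assumes "vacuum_pp_wave D f"
  shows "open (u_range D)" "connected (u_range D)" "u_range D \<noteq> {}"
proof -
  have D: "open D" "connected D" "D \<noteq> {}"
    using assms by (auto simp: vacuum_pp_wave_def)
  have u: "u_range D = fst ` snd ` D"
    by (force simp: u_range_def image_image)
  show "open (u_range D)"
    unfolding u by (intro open_image_fst open_image_snd D)
  show "connected (u_range D)"
    unfolding u by (intro connected_continuous_image continuous_intros D)
  show "u_range D \<noteq> {}"
    using D u by simp
qed

theorem proposition9p2: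
  fixes D :: "point set" and f :: "complex \<Rightarrow> real \<Rightarrow> complex" and A :: "real \<Rightarrow> complex"
    and l n m :: "point \<Rightarrow> complex^4"
  assumes pp_wave: "vacuum_pp_wave D f"
    and A_smooth: "smooth_on (u_range D) A"
    and f_eq: "\<And>\<zeta> u v. (\<zeta>, u, v) \<in> D \<Longrightarrow> f \<zeta> u = exp (4 * A u) * \<zeta>\<^sup>2"
    and tetrad: "null_tetrad D (pp_metric f) l n m" "aligned_tetrad D l"
    and Psi4: "\<And>p. p \<in> D \<Longrightarrow> np_Psi4 (pp_metric f) n m p = 1"
    and Delta_gamma: "\<And>p. p \<in> D \<Longrightarrow> np_Delta n (np_gamma (pp_metric f) l n m) p = 0"
    and Re_gamma: "\<And>p. p \<in> D \<Longrightarrow> Re (np_gamma (pp_metric f) l n m p) \<noteq> 0"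
  shows "\<exists>D2 f2 (k0::real) (k1::real). form_preserving_change D f D2 f2 \<and>
           (\<forall>(\<zeta>, u, v)\<in>D2. u > 0 \<and>
              f2 \<zeta> u = of_real k1 * (of_real u powr (2 * \<i> * of_real k0 - 2)) * \<zeta>\<^sup>2)"
proof -
  define A1 where "A1 u = frechet_derivative A (at u) 1" for u
  define A2 where "A2 u = vector_derivative A1 (at u)" for u
  have A1: "(A has_vector_derivative A1 u) (at u)" if "u \<in> u_range D" for u
    using smooth_on_real_derivatives(1)[OF A_smooth that] by (simp add: A1_def)
  have A2: "A1 differentiable (at u)" "(A1 has_vector_derivative A2 u) (at u)" if "u \<in> u_range D" for u
    using smooth_on_real_derivatives(2)[OF A_smooth that]
    by (simp_all add: A1_def[abs_def] A2_def vector_derivative_works)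
  \<comment> \<open>The factor \<open>4 * A1 u\<close> in \<open>E1\<close> is the logarithmic
    derivative of \<open>E\<close>, so \<open>np_gamma_eq\<close> applies with
    \<open>a = A1 u\<close>.\<close>
  define E E1 E2 where "E u = exp (4 * A u)" and "E1 u = 4 * A1 u * E u"
    and "E2 u = 4 * A1 u * E1 u + 4 * A2 u * E u" for u
  have dE: "(E has_vector_derivative E1 u) (at u)" if "u \<in> u_range D" for u
    using field_vector_diff_chain_at[OF has_vector_derivative_mult_right[OF A1[OF that], of 4] DERIV_exp]
    by (simp add: E_def[abs_def] E1_def o_def mult_ac)
  have dE1: "(E1 has_vector_derivative E2 u) (at u)" if "u \<in> u_range D" for u
    using has_vector_derivative_mult[OF has_vector_derivative_mult_right[OF A2(2)[OF that], of 4] dE[OF that]]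
    by (simp add: E1_def[abs_def] E2_def)
  interpret psi4_tetrad D f E E1 E2 l n m
    using pp_wave f_eq dE dE1 tetrad Psi4
    by unfold_locales (auto simp: vacuum_pp_wave_def E_def)
  define K where "K u = A1 u * of_real (exp (- 2 * Re (A u)))" for u
  note I = vacuum_pp_wave_u_range[OF pp_wave]
  \<comment> \<open>As \<open>l p $ 4\<close> is real and conjugation keeps real parts, the
    condition on gamma passes to \<open>A1\<close> in either orientation.\<close>
  have gamma: "Re (A1 (fst (snd p))) \<noteq> 0" if "p \<in> D" for p
  proof
    assume 0: "Re (A1 (fst (snd p))) = 0"
    have "np_gamma g l n m p = (if m p $ 2 = 0 then cnj (A1 (fst (snd p))) else A1 (fst (snd p))) / l p $ 4"
      using np_gamma_eq[OF that] by (simp add: E1_def)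
    moreover have "Re (z / l p $ 4) = Re z / Re (l p $ 4)" for z
      by (subst l_components(4)[OF that]) simp
    ultimately show False
      using Re_gamma[OF that] 0 by (simp split: if_splits)
  qed
  have K': "(K has_vector_derivative 0) (at u)" and ReK: "Re (K u) \<noteq> 0" if "u \<in> u_range D" for u
  proof -
    obtain p where p: "p \<in> D" "u = fst (snd p)"
      using \<open>u \<in> u_range D\<close> by (force simp: u_range_def)
    have "A differentiable (at u)" "np_gamma g l n m p \<noteq> 0"
      using differentiableI_vector[OF A1[OF that]] Re_gamma[OF p(1)] by auto
    then show "(K has_vector_derivative 0) (at u)"
      unfolding K_def[abs_def] p(2)
      using A2(1)[OF that] Delta_gamma[OF p(1)]
      by (intro has_vector_derivative_zero_if_np_Delta_zero) (simp_all add: p E_def E1_def)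
    show "Re (K u) \<noteq> 0"
      using gamma[OF p(1)] by (simp add: K_def p(2))
  qed
  obtain k where k: "\<And>u. u \<in> u_range D \<Longrightarrow> K u = k"
  proof -
    have "convex (u_range D)"
      using I(2) by (simp add: is_interval_connected_1 flip: is_interval_convex_1)
    from has_vector_derivative_zero_constant[OF this, of K] obtain k where "\<And>u. u \<in> u_range D \<Longrightarrow> K u = k"
      using K' has_vector_derivative_at_within by blast
    then show ?thesis by (rule that)
  qed
  have "Re k \<noteq> 0"
    using I(3) ReK k by fastforce
  moreover have "A1 u = k * of_real (exp (2 * Re (A u)))" if "u \<in> u_range D" for u
    using k[OF that] by (auto simp: K_def mult.assoc simp flip: of_real_mult exp_add)
  ultimately obtain s u0 \<theta> where s: "s = 1 \<or> s = - 1"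
    and sol: "\<And>u. u \<in> u_range D \<Longrightarrow> s * (u + u0) > 0 \<and> exp (4 * A u) = of_real (1 / (4 * (Re k)\<^sup>2)) * cis \<theta> *
        of_real (s * (u + u0)) powr (2 * \<i> * of_real (- Im k / Re k) - 2)"
    using ode_solution[OF I(1,2) A1] by blast
  let ?e = "2 * \<i> * complex_of_real (- Im k / Re k) - 2"
  define f2 where "f2 \<zeta> u = of_real (1 / (4 * (Re k)\<^sup>2)) * (of_real u powr ?e) * \<zeta>\<^sup>2" for \<zeta> :: complex and u :: real
  \<comment> \<open>The angle is halved because a rotation acts twice on the square of \<zeta>.
    Taking \<open>c = s\<close>, which is 1 or -1, reflects \<open>u\<close> if necessary to make it
    positive and leaves \<open>c^2 = 1\<close>.\<close>
  define F where "F = form_preserving_map (\<theta> / 2) u0 s (\<lambda>_. 0) (\<lambda>_. 0)"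
  have div: "(u + u0) / s = s * (u + u0)" for u
    using s by auto
  have "s\<^sup>2 = 1" using s by auto
  have cis: "(cis (\<theta> / 2) * \<zeta>)\<^sup>2 = cis \<theta> * \<zeta>\<^sup>2" for \<zeta>
    by (simp add: power_mult_distrib power2_eq_square cis_mult)
  have "f2 (cis (\<theta> / 2) * \<zeta>) ((u + u0) / s) = f \<zeta> u" if "(\<zeta>, u, v) \<in> D" for \<zeta> u v
    using sol[OF u_in_range[OF that]] f_eq[OF that] unfolding f2_def div cis by (simp add: E_def mult_ac)
  then have "form_preserving_change D f (F ` D) f2"
    unfolding form_preserving_change_def F_def
    by (intro exI[of _ "\<theta> / 2"] exI[of _ u0] exI[of _ s] exI[of _ "\<lambda>_. 0"] exI[of _ "\<lambda>_. 0"])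
      (use s \<open>s\<^sup>2 = 1\<close> in \<open>auto simp: smooth_on_zero Let_def\<close>)
  moreover have "\<forall>(\<zeta>, u, v)\<in>F ` D. u > 0 \<and>
      f2 \<zeta> u = of_real (1 / (4 * (Re k)\<^sup>2)) * (of_real u powr (2 * \<i> * of_real (- Im k / Re k) - 2)) * \<zeta>\<^sup>2"
    using sol u_in_range unfolding F_def form_preserving_map_def f2_def by (auto simp: div Let_def)
  ultimately show ?thesis by blast
qed

end
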